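(* Let $g\ge 2$ be an integer. There exists a positive constant $c_1$ depending on $g$ such that for all real $x\ge 2$, $$\bigl|\{n\le x:\ n=p_1+p_2,\ p_1 \text{ and } p_2 \text{ are base } g \text{ palindromes}\}\bigr|\ge x^{1-\frac{c_1}{\sqrt{\log x}}}.$$
   Context: Here $n$ ranges over positive integers. Every nonnegative integer has a unique base $g$ representation $\delta_{l-1}\cdots\delta_0$ with digits $0\le \delta_j\le g-1$ and $\delta_{l-1}\ne 0$; it is a base $g$ palindrome if $\delta_{l-i}=\delta_{i-1}$ for all $i=1,\dots,\lfloor l/2\rfloor$. By convention $0$ is also considered a base $g$ palindrome. *)

theory Defs
  imports Complex_Main
begin

text \<open>The digits are \<open>\<delta> 0, \<dots>, \<delta> (l - 1)\<close>, least significant first; values of \<open>\<delta>\<close> at indices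
  \<open>\<ge> l\<close> are irrelevant. The number \<open>0\<close> has no representation in this sense, since a
  representation has a nonzero leading digit.\<close>

definition base_rep :: "nat \<Rightarrow> nat \<Rightarrow> nat \<Rightarrow> (nat \<Rightarrow> nat) \<Rightarrow> bool" where
  "base_rep g n l \<delta> \<longleftrightarrow>
     l \<ge> 1 \<and> (\<forall>j<l. \<delta> j \<le> g - 1) \<and> \<delta> (l - 1) \<noteq> 0 \<and> n = (\<Sum>j<l. \<delta> j * g ^ j)"

definition base_palindrome :: "nat \<Rightarrow> nat \<Rightarrow> bool" where
  "base_palindrome g n \<longleftrightarrow>
     n = 0 \<or> (\<exists>l \<delta>. base_rep g n l \<delta> \<and> (\<forall>i\<in>{1..l div 2}. \<delta> (l - i) = \<delta> (i - 1)))"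

end

theory Submission
  imports Defs "HOL-Library.FuncSet"
begin

text \<open>Let \<open>L = m k\<close>. A palindrome of length \<open>L\<close> is fixed by the reflection \<open>j \<mapsto> L - 1 - j\<close> of digit
  positions, one of length \<open>L - k\<close> by \<open>j \<mapsto> L - k - 1 - j\<close>; the composition of the two is a shift by
  \<open>k\<close>. Cut the positions into \<open>m\<close> blocks of length \<open>k\<close>. The sum \<open>n\<close> of two such palindromes together
  with the \<open>m\<close> binary carries at the block boundaries determines all block sums. The top block
  belongs to the first palindrome only, so it is determined; reflecting it gives the lowest block of
  the first palindrome, hence by subtraction the lowest block of the second, hence by reflection the
  second highest block of the second, and so on. Thus each \<open>n\<close> has at most \<open>2 ^ m\<close> representations,
  while there are about \<open>g ^ (L - k / 2)\<close> pairs. Taking \<open>m\<close> and \<open>k\<close> of order \<open>sqrt (ln x)\<close> balances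
  the two losses.\<close>

section \<open>Base \<open>g\<close> digit sums\<close>

lemma digit_sum_less:
  fixes g :: nat
  assumes "\<forall>j<n. d j < g"
  shows "(\<Sum>j<n. d j * g ^ j) < g ^ n"
  using assms
proof (induction n)
  case (Suc n)
  then have "(\<Sum>j<n. d j * g ^ j) + d n * g ^ n < g ^ n + d n * g ^ n"
    by simp
  also have "\<dots> = (d n + 1) * g ^ n"
    by (simp add: algebra_simps)
  also have "\<dots> \<le> g * g ^ n"
    using Suc.prems by (intro mult_right_mono) (auto simp: Suc_le_eq)
  finally show ?case
    by simp
qed simp

lemma digit_sum_inj:
  fixes g :: nat
  assumes "\<forall>j<n. d j < g" "\<forall>j<n. e j < g"
    and "(\<Sum>j<n. d j * g ^ j) = (\<Sum>j<n. e j * g ^ j)"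
  shows "\<forall>j<n. d j = e j"
  using assms
proof (induction n)
  case (Suc n)
  let ?s = "\<lambda>d. \<Sum>j<n. d j * g ^ j"
  have less: "?s d < g ^ n" "?s e < g ^ n"
    using Suc.prems by (auto intro!: digit_sum_less)
  have eq: "?s d + d n * g ^ n = ?s e + e n * g ^ n"
    using Suc.prems by simp
  from less have pos: "g ^ n \<noteq> 0"
    by linarith
  have "d n = (?s d + d n * g ^ n) div g ^ n"
    using less unfolding div_mult_self1[OF pos] by simp
  also have "\<dots> = e n"
    using less unfolding eq div_mult_self1[OF pos] by simp
  finally have "d n = e n" .
  moreover from this eq have "?s d = ?s e"
    by simp
  then have "\<forall>j<n. d j = e j"
    using Suc.prems by (intro Suc.IH) auto
  ultimately show ?case
    using less_Suc_eq by auto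
qed simp

lemma sum_split_block:
  fixes f :: "nat \<Rightarrow> nat"
  shows "(\<Sum>j<Suc i * k. f j * g ^ j) =
    (\<Sum>j<i * k. f j * g ^ j) + g ^ (i * k) * (\<Sum>j<k. f (i * k + j) * g ^ j)"
proof -
  have "(\<Sum>j<a + k. f j * g ^ j) =
    (\<Sum>j<a. f j * g ^ j) + (\<Sum>j<k. f (a + j) * g ^ (a + j))" for a
    by (induction k) auto
  from this[of "i * k"] show ?thesis
    by (simp add: sum_distrib_left power_add algebra_simps)
qed

section \<open>Palindromes from their free digits, and recovery of a pair from its block
  sums\<close>

definition sym_digits :: "nat \<Rightarrow> (nat \<Rightarrow> nat) \<Rightarrow> nat \<Rightarrow> nat" where
  "sym_digits L f j =
     (if j < L then let i = min j (L - 1 - j) in if i = 0 then 1 else f i else 0)"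

text \<open>Position \<open>0\<close> is excluded because \<open>sym_digits\<close> fixes the two
  outer digits to \<open>1\<close>, which keeps the leading digit nonzero. Beyond position
  \<open>L\<close> it pads with \<open>0\<close>, so strings of different lengths can be added
  position by position.\<close>

abbreviation half_digits :: "nat \<Rightarrow> nat \<Rightarrow> (nat \<Rightarrow> nat) set" where
  "half_digits g L \<equiv> {1..<(L + 1) div 2} \<rightarrow>\<^sub>E {..<g}"

lemma sym_digits_less:
  assumes "f \<in> half_digits g L" "2 \<le> g"
  shows "sym_digits L f j < g"
proof (cases "j < L \<and> min j (L - 1 - j) \<noteq> 0")
  case True
  then have "min j (L - 1 - j) \<in> {1..<(L + 1) div 2}"
    by (auto simp: min_def)
  then have "f (min j (L - 1 - j)) < g"
    using assms(1) by (metis PiE_mem lessThan_iff)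
  then show ?thesis
    using True assms(2) by (auto simp: sym_digits_def Let_def)
qed (use assms in \<open>auto simp: sym_digits_def Let_def\<close>)

lemma sym_digits_reflect:
  assumes "j < L"
  shows "sym_digits L f (L - 1 - j) = sym_digits L f j"
proof -
  have "min (L - 1 - j) (L - 1 - (L - 1 - j)) = min j (L - 1 - j)"
    using assms by auto
  then show ?thesis
    using assms by (simp add: sym_digits_def)
qed

lemma sym_digits_eq_0: "L \<le> j \<Longrightarrow> sym_digits L f j = 0"
  by (simp add: sym_digits_def)

lemma half_digits_eqI:
  assumes "f \<in> half_digits g L" "f' \<in> half_digits g L"
    and "\<And>j. j < L \<Longrightarrow> sym_digits L f j = sym_digits L f' j"
  shows "f = f'"
proof (rule PiE_ext[OF assms(1,2)])
  fix i assume "i \<in> {1..<(L + 1) div 2}"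
  then have "i < L" "min i (L - 1 - i) = i" "i \<noteq> 0"
    by auto
  then show "f i = f' i"
    using assms(3)[of i] by (simp add: sym_digits_def)
qed

lemma base_palindrome_sym_digits:
  assumes "f \<in> half_digits g L" "2 \<le> g" "1 \<le> L"
  shows "base_palindrome g (\<Sum>j<L. sym_digits L f j * g ^ j)"
proof -
  have "sym_digits L f j \<le> g - 1" for j
    using sym_digits_less[OF assms(1,2), of j] by simp
  moreover have "sym_digits L f (L - 1) \<noteq> 0"
    using assms(3) by (simp add: sym_digits_def)
  moreover have "sym_digits L f (L - i) = sym_digits L f (i - 1)" if "i \<in> {1..L div 2}" for i
    using sym_digits_reflect[of "i - 1" L f] that by auto
  ultimately show ?thesis
    using assms(3) unfolding base_palindrome_def base_rep_def by blast
qed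

text \<open>Blocks are recovered alternately from the top and from the bottom: the two reflections
  differ by a shift of \<open>k\<close>, so each round reaches one block further down. No carry
  enters, since \<open>blocks\<close> compares block sums before carrying.\<close>

lemma palindrome_pair_determined:
  fixes g k m :: nat and \<alpha> \<alpha>' \<beta> \<beta>' :: "nat \<Rightarrow> nat"
  defines "L \<equiv> m * k"
  assumes digits: "\<And>j. \<alpha> j < g" "\<And>j. \<alpha>' j < g" "\<And>j. \<beta> j < g" "\<And>j. \<beta>' j < g"
    and refl\<alpha>: "\<And>j. j < L \<Longrightarrow> \<alpha> (L - 1 - j) = \<alpha> j" "\<And>j. j < L \<Longrightarrow> \<alpha>' (L - 1 - j) = \<alpha>' j"
    and refl\<beta>: "\<And>j. j < L - k \<Longrightarrow> \<beta> (L - k - 1 - j) = \<beta> j"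
      "\<And>j. j < L - k \<Longrightarrow> \<beta>' (L - k - 1 - j) = \<beta>' j"
    and zero: "\<And>j. L - k \<le> j \<Longrightarrow> \<beta> j = 0" "\<And>j. L - k \<le> j \<Longrightarrow> \<beta>' j = 0"
    and blocks: "\<And>i. i < m \<Longrightarrow>
      (\<Sum>j<k. (\<alpha> (i * k + j) + \<beta> (i * k + j)) * g ^ j) =
      (\<Sum>j<k. (\<alpha>' (i * k + j) + \<beta>' (i * k + j)) * g ^ j)"
  shows "\<forall>j<L. \<alpha> j = \<alpha>' j \<and> \<beta> j = \<beta>' j"
proof -
  have \<alpha>_block: "\<forall>j<k. \<alpha> (i * k + j) = \<alpha>' (i * k + j)"
    if "i < m" "\<forall>j<k. \<beta> (i * k + j) = \<beta>' (i * k + j)" for i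
    using blocks[OF that(1)] that(2) digits
    by (intro digit_sum_inj[of k _ g]) (auto simp: add_mult_distrib sum.distrib)
  have \<beta>_block: "\<forall>j<k. \<beta> (i * k + j) = \<beta>' (i * k + j)"
    if "i < m" "\<forall>j<k. \<alpha> (i * k + j) = \<alpha>' (i * k + j)" for i
    using blocks[OF that(1)] that(2) digits
    by (intro digit_sum_inj[of k _ g]) (auto simp: add_mult_distrib sum.distrib)
  \<comment> \<open>After \<open>i\<close> rounds \<alpha> is known on the top \<open>i\<close>
    blocks and \<beta> on one block more. The lead of one block is there from the start, because
    \<beta> vanishes on the top block.\<close>
  have "\<forall>j<L. (L \<le> j + i * k \<longrightarrow> \<alpha> j = \<alpha>' j) \<and> (L \<le> j + Suc i * k \<longrightarrow> \<beta> j = \<beta>' j)"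
    if "i \<le> m" for i
    using that
  proof (induction i)
    case 0
    then show ?case
      using zero by auto
  next
    case (Suc i)
    then have IH: "\<And>j. j < L \<Longrightarrow> L \<le> j + i * k \<Longrightarrow> \<alpha> j = \<alpha>' j"
        "\<And>j. j < L \<Longrightarrow> L \<le> j + Suc i * k \<Longrightarrow> \<beta> j = \<beta>' j"
      by auto
    define t where "t = m - Suc i"
    have t: "t < m" "t * k + Suc i * k = L"
      using Suc.prems by (auto simp: t_def L_def simp del: mult_Suc simp flip: add_mult_distrib)
    have "\<forall>j<k. \<beta> (t * k + j) = \<beta>' (t * k + j)"
      using t IH(2) by auto
    then have top: "\<forall>j<k. \<alpha> (t * k + j) = \<alpha>' (t * k + j)"
      by (rule \<alpha>_block[OF t(1)])
    have \<alpha>: "\<alpha> j = \<alpha>' j" if "j < L" "L \<le> j + Suc i * k" for j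
    proof (cases "L \<le> j + i * k")
      case False
      then have "j - t * k < k" "t * k + (j - t * k) = j"
        using that t by auto
      then show ?thesis
        using top by metis
    qed (use IH that in auto)
    \<comment> \<open>The reflection of \<alpha> swaps block \<open>t\<close> with block
      \<open>i\<close>.\<close>
    have "\<forall>j<k. \<alpha> (i * k + j) = \<alpha>' (i * k + j)"
    proof (intro allI impI)
      fix j assume "j < k"
      then have "i * k + j < L" "L \<le> L - 1 - (i * k + j) + Suc i * k"
        using t by auto
      then show "\<alpha> (i * k + j) = \<alpha>' (i * k + j)"
        using refl\<alpha>[of "i * k + j"] \<alpha>[of "L - 1 - (i * k + j)"] by simp
    qed
    then have bottom: "\<forall>j<k. \<beta> (i * k + j) = \<beta>' (i * k + j)"
      using Suc.prems by (intro \<beta>_block) auto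
    \<comment> \<open>The shorter reflection of \<beta> takes block \<open>i\<close> to the block
      just below block \<open>t\<close>, which restores the lead.\<close>
    have \<beta>: "\<beta> j = \<beta>' j" if "j < L" "L \<le> j + Suc (Suc i) * k" for j
    proof (cases "L \<le> j + Suc i * k")
      case False
      then have j: "j < L - k" "L - k - 1 - j - i * k < k"
          "i * k + (L - k - 1 - j - i * k) = L - k - 1 - j"
        using that by auto
      then have "\<beta> (L - k - 1 - j) = \<beta>' (L - k - 1 - j)"
        using bottom by metis
      then show ?thesis
        using refl\<beta>[OF j(1)] by simp
    qed (use IH that in auto)
    show ?case
      using \<alpha> \<beta> by blast
  qed
  from this[of m] show ?thesis
    by (auto simp: L_def)
qed

section \<open>Counting sums of two palindromes\<close>

abbreviation palindrome_sums :: "nat \<Rightarrow> nat \<Rightarrow> nat set" where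
  "palindrome_sums g N \<equiv> {n. 0 < n \<and> n \<le> N \<and>
     (\<exists>p q. n = p + q \<and> base_palindrome g p \<and> base_palindrome g q)}"

text \<open>The exponent on the left counts the free digits of a pair. The map sending a pair to its
  sum and its \<open>m\<close> carries is injective, and each carry is \<open>0\<close> or
  \<open>1\<close>.\<close>

lemma card_palindrome_sums_blocks:
  fixes g k m :: nat
  assumes g: "2 \<le> g" and k: "1 \<le> k" and m: "2 \<le> m"
  defines "L \<equiv> m * k"
  shows "g ^ ((L + 1) div 2 - 1 + ((L - k + 1) div 2 - 1))
    \<le> card (palindrome_sums g (g ^ (L + 1))) * 2 ^ m"
proof -
  define D where "D = half_digits g L \<times> half_digits g (L - k)"
  define s where "s = (\<lambda>(f, h) j. sym_digits L f j + sym_digits (L - k) h j)"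
  define low where "low p i = (\<Sum>j<i * k. s p j * g ^ j)" for p i
  define carry where "carry p i = low p i div g ^ (i * k)" for p i
  \<comment> \<open>\<open>low p m\<close> is the sum itself, so only carries at boundaries
    \<open>i < m\<close> are recorded; \<open>restrict\<close> places them in a function space of
    cardinality \<open>2 ^ m\<close>.\<close>
  define F where "F p = (low p m, restrict (carry p) {..<m})" for p
  have kL: "k \<le> L" "1 \<le> L - k"
  proof -
    have "2 * k \<le> L"
      using m by (auto simp: L_def)
    then show "k \<le> L" "1 \<le> L - k"
      using k by auto
  qed
  have less: "sym_digits L f j < g" "sym_digits (L - k) h j < g" if "(f, h) \<in> D" for f h j
    using that sym_digits_less[OF _ g] unfolding D_def by blast+
  have low_eq: "low (f, h) i = (\<Sum>j<i * k. sym_digits L f j * g ^ j) +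
      (\<Sum>j<i * k. sym_digits (L - k) h j * g ^ j)" for f h i
    by (simp add: low_def s_def add_mult_distrib sum.distrib)
  have low_less: "low p i < 2 * g ^ (i * k)" if "p \<in> D" for p i
  proof -
    obtain f h where p: "p = (f, h)"
      by force
    have "(\<Sum>j<i * k. sym_digits L f j * g ^ j) < g ^ (i * k)"
      "(\<Sum>j<i * k. sym_digits (L - k) h j * g ^ j) < g ^ (i * k)"
      using less that by (auto simp: p intro!: digit_sum_less)
    then show ?thesis
      by (simp add: p low_eq)
  qed
  \<comment> \<open>Blocks from \<open>i\<close> upwards contribute multiples of
    \<open>g ^ (i * k)\<close>.\<close>
  have low_sum: "low p m mod g ^ (i * k) = low p i mod g ^ (i * k)" if "i \<le> m" for p i
    using that
  proof (induction rule: inc_induct)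
    case (step n)
    have "low p m mod g ^ (n * k) = low p m mod g ^ (Suc n * k) mod g ^ (n * k)"
      by (simp add: mod_mod_cancel le_imp_power_dvd)
    also have "\<dots> = low p (Suc n) mod g ^ (n * k)"
      unfolding step.IH by (intro mod_mod_cancel le_imp_power_dvd) simp
    also have "\<dots> = low p n mod g ^ (n * k)"
      unfolding low_def sum_split_block by simp
    finally show ?case .
  qed simp
  have "inj_on F D"
  proof (rule inj_onI)
    fix p p' assume p: "p \<in> D" "p' \<in> D" and F: "F p = F p'"
    obtain f h f' h' where fh: "p = (f, h)" "p' = (f', h')"
      by (metis surj_pair)
    \<comment> \<open>The sum gives the remainder of \<open>low p i\<close> modulo
      \<open>g ^ (i * k)\<close> and the carry gives the quotient; consecutive values then differ by
      one scaled block sum.\<close>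
    have low: "low p i = low p' i" if "i \<le> m" for i
    proof (cases "i = m")
      case False
      with that have "i \<in> {..<m}"
        by simp
      with F have "carry p i = carry p' i"
        unfolding F_def by (metis prod.inject restrict_apply')
      moreover have "low p i mod g ^ (i * k) = low p' i mod g ^ (i * k)"
        using F low_sum[OF that] by (simp add: F_def flip: low_sum[OF that])
      ultimately show ?thesis
        unfolding carry_def by (metis div_mult_mod_eq)
    qed (use F in \<open>simp add: F_def\<close>)
    have blocks: "(\<Sum>j<k. s p (i * k + j) * g ^ j) = (\<Sum>j<k. s p' (i * k + j) * g ^ j)"
      if "i < m" for i
      using low[of i] low[of "Suc i"] that g
      unfolding low_def sum_split_block by simp
    have "\<forall>j<L. sym_digits L f j = sym_digits L f' j \<and>
        sym_digits (L - k) h j = sym_digits (L - k) h' j"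
      unfolding L_def
    proof (rule palindrome_pair_determined[where g = g]; fold L_def)
      fix i assume "i < m"
      then show "(\<Sum>j<k. (sym_digits L f (i * k + j) + sym_digits (L - k) h (i * k + j)) * g ^ j) =
          (\<Sum>j<k. (sym_digits L f' (i * k + j) + sym_digits (L - k) h' (i * k + j)) * g ^ j)"
        using blocks[of i] by (simp add: fh s_def)
    qed (use less p fh sym_digits_reflect sym_digits_eq_0 in blast)+
    then show "p = p'"
      using p by (auto simp: fh D_def L_def[symmetric] intro!: half_digits_eqI)
  qed
  moreover have "F ` D \<subseteq> palindrome_sums g (g ^ (L + 1)) \<times> ({..<m} \<rightarrow>\<^sub>E {..<2})"
  proof
    fix y assume "y \<in> F ` D"
    then obtain f h where fh: "(f, h) \<in> D" and y: "y = F (f, h)"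
      by auto
    let ?a = "\<Sum>j<L. sym_digits L f j * g ^ j"
    let ?b = "\<Sum>j<L - k. sym_digits (L - k) h j * g ^ j"
    have "sym_digits L f 0 * g ^ 0 \<le> ?a"
      using kL by (intro member_le_sum) auto
    moreover have "sym_digits L f 0 = 1"
      using kL by (simp add: sym_digits_def)
    ultimately have a_pos: "0 < ?a"
      by simp
    have "(\<Sum>j<L. sym_digits (L - k) h j * g ^ j) = ?b"
      by (rule sum.mono_neutral_right) (auto simp: sym_digits_eq_0)
    then have "low (f, h) m = ?a + ?b"
      by (simp add: low_eq flip: L_def)
    moreover have "base_palindrome g ?a" "base_palindrome g ?b"
      using fh g kL by (auto simp: D_def intro!: base_palindrome_sym_digits)
    moreover have "low (f, h) m \<le> g ^ (L + 1)"
      using low_less[OF fh, of m] mult_right_mono[OF g, of "g ^ L"]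
      unfolding L_def[symmetric] by (simp only: Suc_eq_plus1[symmetric] power_Suc) linarith
    moreover have "carry (f, h) i < 2" for i
      using low_less[OF fh, of i] by (simp add: carry_def less_mult_imp_div_less)
    ultimately show "y \<in> palindrome_sums g (g ^ (L + 1)) \<times> ({..<m} \<rightarrow>\<^sub>E {..<2})"
      using a_pos unfolding y F_def by auto
  qed
  moreover have "finite (palindrome_sums g (g ^ (L + 1)) \<times> ({..<m} \<rightarrow>\<^sub>E {..<2::nat}))"
    by (intro finite_cartesian_product finite_PiE) auto
  ultimately have "card D \<le> card (palindrome_sums g (g ^ (L + 1)) \<times> ({..<m} \<rightarrow>\<^sub>E {..<2::nat}))"
    by (rule card_inj_on_le)
  then show ?thesis
    by (simp add: D_def card_cartesian_product card_PiE power_add)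
qed

text \<open>Taking \<open>m = k - 1\<close> blocks leaves room for the last carry, as
  \<open>L + 1 \<le> k * k\<close>. The free digits exceed the claimed exponent by at least
  \<open>k\<close>, and this surplus absorbs the factor
  \<open>2 ^ (k - 1) \<le> g ^ k\<close>.\<close>

lemma card_palindrome_sums:
  assumes g: "2 \<le> g" and k: "4 \<le> k"
  shows "g ^ (k * (k - 4)) \<le> card (palindrome_sums g (g ^ (k * k)))"
proof -
  define L where "L = (k - 1) * k"
  let ?e = "(L + 1) div 2 - 1 + ((L - k + 1) div 2 - 1)"
  obtain r where r: "k = r + 4"
    using k by (metis add.commute le_Suc_ex)
  have "k * (k - 4) + k \<le> ?e"
    by (simp add: L_def r algebra_simps)
  then have "g ^ (k * (k - 4) + k) \<le> g ^ ?e"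
    using g by (intro power_increasing) auto
  also have "\<dots> \<le> card (palindrome_sums g (g ^ (L + 1))) * 2 ^ (k - 1)"
    unfolding L_def by (rule card_palindrome_sums_blocks) (use g k in auto)
  also have "\<dots> \<le> card (palindrome_sums g (g ^ (k * k))) * g ^ k"
  proof (rule mult_mono)
    have "g ^ (L + 1) \<le> g ^ (k * k)"
      using g by (intro power_increasing) (auto simp: L_def r algebra_simps)
    then show "card (palindrome_sums g (g ^ (L + 1))) \<le> card (palindrome_sums g (g ^ (k * k)))"
      by (intro card_mono) auto
    have "(2::nat) ^ (k - 1) \<le> 2 ^ k"
      by (intro power_increasing) auto
    also have "\<dots> \<le> g ^ k"
      using g by (rule power_mono) simp
    finally show "2 ^ (k - 1) \<le> g ^ k" .
  qed auto
  finally show ?thesis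
    using g by (simp add: power_add)
qed

section \<open>Choice of the length for a given \<open>x\<close>\<close>

theorem theorem1p2:
  fixes g :: nat
  assumes "g \<ge> 2"
  shows "\<exists>c\<^sub>1::real. c\<^sub>1 > 0 \<and> (\<forall>x::real. x \<ge> 2 \<longrightarrow>
           real (card {n::nat. n > 0 \<and> real n \<le> x \<and>
             (\<exists>p\<^sub>1 p\<^sub>2. n = p\<^sub>1 + p\<^sub>2 \<and> base_palindrome g p\<^sub>1 \<and> base_palindrome g p\<^sub>2)})
           \<ge> x powr (1 - c\<^sub>1 / sqrt (ln x)))"
proof (intro exI[of _ "7 * sqrt (ln (real g))"] conjI allI impI)
  show "7 * sqrt (ln (real g)) > 0"
    using assms by simp
next
  fix x :: real assume x: "2 \<le> x"
  let ?A = "{n::nat. n > 0 \<and> real n \<le> x \<and>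
    (\<exists>p q. n = p + q \<and> base_palindrome g p \<and> base_palindrome g q)}"
  \<comment> \<open>Then \<open>x = g powr s\<^sup>2\<close>, and the claimed bound becomes
    \<open>g powr (s\<^sup>2 - 7 * s)\<close>. Replacing \<open>s\<close> by its floor
    \<open>k\<close> costs at most \<open>2 * s\<close> in the exponent \<open>s\<^sup>2\<close>,
    and \<open>k * (k - 4)\<close> loses at most \<open>4 * s\<close> more; the constant
    \<open>7\<close> covers both.\<close>
  define s where "s = sqrt (log g x)"
  define k where "k = nat \<lfloor>s\<rfloor>"
  have lg: "0 < ln (real g)" and lx: "0 < ln x"
    using assms x by auto
  have s0: "0 < s"
    using lg lx by (simp add: s_def log_def)
  have k: "real k \<le> s" "s < real k + 1"
    using s0 by (auto simp: k_def)
  have s2: "s\<^sup>2 * ln (real g) = ln x"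
    using lg lx by (simp add: s_def log_def)
  have "7 * sqrt (ln (real g)) / sqrt (ln x) * ln x = 7 * s * ln (real g)"
  proof -
    have "sqrt (ln x) = s * sqrt (ln (real g))"
      using s2 s0 by (metis real_sqrt_mult real_sqrt_abs abs_of_pos)
    then have "7 * sqrt (ln (real g)) / sqrt (ln x) = 7 / s"
      using lg by simp
    then show ?thesis
      using s0 by (simp add: power2_eq_square flip: s2)
  qed
  then have "x powr (1 - 7 * sqrt (ln (real g)) / sqrt (ln x))
      = exp (s\<^sup>2 * ln (real g) - 7 * s * ln (real g))"
    using x by (simp add: powr_def left_diff_distrib s2)
  also have "\<dots> = g powr (s\<^sup>2 - 7 * s)"
    using assms by (simp add: powr_def left_diff_distrib)
  also have "\<dots> \<le> card ?A"
  proof -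
    have fin: "finite ?A"
      by (rule finite_subset[of _ "{..nat \<lfloor>x\<rfloor>}"]) (auto simp: le_nat_floor)
    show ?thesis
    proof (cases "k < 4")
      \<comment> \<open>Here \<open>s < 4 < 7\<close>, so the bound is at most \<open>1\<close>, and
        \<open>1 = 1 + 0\<close> is already a sum of two palindromes.\<close>
      case True
      then have "s * (s - 7) \<le> 0"
        using k s0 by (intro mult_nonneg_nonpos) auto
      then have "g powr (s\<^sup>2 - 7 * s) \<le> g powr 0"
        using assms by (intro powr_mono) (auto simp: power2_eq_square algebra_simps)
      also have "\<dots> = card {1::nat}"
        using assms by simp
      also have "\<dots> \<le> card ?A"
      proof -
        have "base_rep g 1 1 (\<lambda>_. 1)"
          using assms by (simp add: base_rep_def)
        then have "base_palindrome g 1" "base_palindrome g 0"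
          unfolding base_palindrome_def by (auto intro!: exI[of _ 1])
        then have "\<exists>p q. 1 = p + q \<and> base_palindrome g p \<and> base_palindrome g q"
          by (metis add_0_right)
        then have "{1} \<subseteq> ?A"
          using x by simp
        then show ?thesis
          using fin by (intro of_nat_mono card_mono)
      qed
      finally show ?thesis .
    next
      case False
      then have k4: "4 \<le> k"
        by simp
      have "s\<^sup>2 - 7 * s = s * (s - 7)"
        by (simp add: power2_eq_square algebra_simps)
      also have "\<dots> \<le> real k * (real k - 4)"
      proof -
        \<comment> \<open>The two sides of the goal differ by
          \<open>(s - k) * (s + k - 7) - 3 * k\<close>.\<close>
        have "(s - real k) * (s + real k - 7) \<le> (s - real k) * (3 * real k)"
          using k k4 by (intro mult_left_mono) auto
        also have "\<dots> \<le> 1 * (3 * real k)"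
          using k by (intro mult_right_mono) auto
        finally show ?thesis
          by (simp add: algebra_simps)
      qed
      finally have "g powr (s\<^sup>2 - 7 * s) \<le> g powr real (k * (k - 4))"
        using assms k4 by (intro powr_mono) (auto simp: of_nat_diff)
      also have "\<dots> = real (g ^ (k * (k - 4)))"
        using assms by (simp add: powr_realpow del: of_nat_mult)
      also have "\<dots> \<le> card (palindrome_sums g (g ^ (k * k)))"
        using card_palindrome_sums[OF assms k4] by (rule of_nat_mono)
      also have "\<dots> \<le> card ?A"
      proof -
        have "real (g ^ (k * k)) = g powr (real k)\<^sup>2"
          using assms by (simp add: powr_realpow power2_eq_square flip: of_nat_mult)
        also have "\<dots> \<le> g powr s\<^sup>2"
          using assms k by (intro powr_mono power_mono) auto
        also have "\<dots> = x"
          using assms x by (simp add: powr_def s2)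
        finally have "n \<le> g ^ (k * k) \<Longrightarrow> real n \<le> x" for n
          using of_nat_mono[of n "g ^ (k * k)", where 'a = real] by linarith
        then have "palindrome_sums g (g ^ (k * k)) \<subseteq> ?A"
          by auto
        then show ?thesis
          using fin by (intro of_nat_mono card_mono)
      qed
      finally show ?thesis .
    qed
  qed
  finally show "x powr (1 - 7 * sqrt (ln (real g)) / sqrt (ln x)) \<le> card ?A" .
qed

end
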